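(* Let $G=(Q,\Sigma,\delta,I)$ be a discrete-event system with $\Sigma=\Sigma_o\,\dot\cup\,\Sigma_{uo}$ and projection $P\colon\Sigma^*\to\Sigma_o^*$, let $Q_S,Q_{NS}\subseteq Q$ be the sets of secret and nonsecret states, and let $k\in\mathbb{N}\cup\{\infty\}$. Then $G$ is weakly $k$-step opaque with respect to $Q_S$, $Q_{NS}$ and $P$ if and only if the algorithm WeakOpacity (described in the context) returns $\mathtt{true}$ on input $(G,Q_S,Q_{NS},\Sigma_o,k)$.
   Context: A discrete-event system (DES) $G=(Q,\Sigma,\delta,I)$ is a nondeterministic finite automaton: $Q$ is a finite set of states, $\Sigma$ is a finite nonempty alphabet partitioned into observable events $\Sigma_o$ and unobservable events $\Sigma_{uo}$, $I\subseteq Q$ is a nonempty set of initial states, and $\delta\colon Q\times\Sigma\to 2^Q$ is the transition function, extended as usual to $2^Q\times\Sigma^*$; for $S\subseteq\Sigma^*$ and $A\subseteq Q$, $\delta(A,S)=\bigcup_{s\in S}\delta(A,s)$. The generated language is $L(G)=\{w\in\Sigma^*\mid\delta(I,w)\ne\emptyset\}$. The projection $P\colon\Sigma^*\to\Sigma_o^*$ is the monoid morphism erasing the unobservable events and fixing the observable ones. Weak $k$-step opacity: for $k\in\mathbb{N}\cup\{\infty\}$ (where $\mathbb{N}$ is the set of nonnegative integers), $G$ is weakly $k$-step opaque with respect to $Q_S$, $Q_{NS}$ and $P$ if for every string $st\in L(G)$ with $|P(t)|\le k$ and $\delta(\delta(I,s)\cap Q_S,t)\ne\emptyset$, there is a string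 $s't'\in L(G)$ such that $P(s)=P(s')$, $P(t)=P(t')$ and $\delta(\delta(I,s')\cap Q_{NS},t')\ne\emptyset$. States may be neutral, i.e. neither in $Q_S$ nor in $Q_{NS}$. The projected automaton $P(G)$ is the NFA over $\Sigma_o$ with the same states as $G$ and transition function $\gamma(q,a)=\delta(q,P^{-1}(a))$, $a\in\Sigma_o$; its set of initial states is $\delta(I,P^{-1}(\varepsilon))$. The full observer of $G$ is the DFA obtained from $P(G)$ by the subset construction: its states are all subsets of $Q$ (including $\emptyset$), its initial state is $\delta(I,P^{-1}(\varepsilon))$, and its transitions are $X\xrightarrow{a}\gamma(X,a)=\bigcup_{q\in X}\gamma(q,a)$. The observer $G^{obs}$ is the part of the full observer accessible from its initial state. The product $G_1\times G_2$ of two automata over the same alphabet has the state set $Q_1\times Q_2$ (not restricted to the reachable part) and transitions $\delta((q_1,q_2),a)=\delta_1(q_1,a)\times\delta_2(q_2,a)$. Algorithm WeakOpacity on input $(G,Q_S,Q_{NS},\Sigma_o,k)$: 1. Set $Y:=\emptyset$; compute $G^{obs}$ and $P(G)$. 2. For every state $X$ of $G^{obs}$ and every $x\in X\cap Q_S$, add the pair $(x,X\cap Q_{NS})$ to $Y$. 3. Construct $H$ as the part of the full observer of $G$ accessible from the states that occur as second components of pairs in $Y$. 4. Compute the product automaton $\mathcal{C}=P(G)\times H$. 5. By a breadth-first search started from $Y$, mark all states of $\mathcal{C}$ reachable from the states of $Y$ in at most $k$ steps. 6. If $\mathcal{C}$ contains a marked state of the form $(q,\emptyset)$, return $\mathtt{false}$;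 otherwise return $\mathtt{true}$. *)

theory Defs
  imports Main "HOL-Library.Extended_Nat" "HOL-Library.While_Combinator"
begin

text \<open>Values of \<open>trans\<close> at arguments outside \<open>states\<close> and \<open>alphabet\<close> carry no meaning; all
  words below are taken from \<open>lists (alphabet A)\<close>.\<close>

record ('q, 'a) automaton =
  states :: "'q set"
  alphabet :: "'a set"
  trans :: "'q \<Rightarrow> 'a \<Rightarrow> 'q set"
  init :: "'q set"

definition des :: "('q, 'a) automaton \<Rightarrow> bool" where
  "des G \<longleftrightarrow>
     finite (states G) \<and> finite (alphabet G) \<and> alphabet G \<noteq> {} \<and>
     init G \<subseteq> states G \<and> init G \<noteq> {} \<and>
     (\<forall>q\<in>states G. \<forall>a\<in>alphabet G. trans G q a \<subseteq> states G)"

definition step :: "('q, 'a) automaton \<Rightarrow> 'q set \<Rightarrow> 'a \<Rightarrow> 'q set" where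
  "step A X a = (\<Union>q\<in>X. trans A q a)"

fun steps :: "('q, 'a) automaton \<Rightarrow> 'q set \<Rightarrow> 'a list \<Rightarrow> 'q set" where
  "steps A X [] = X"
| "steps A X (a # w) = steps A (step A X a) w"

definition steps_lang :: "('q, 'a) automaton \<Rightarrow> 'q set \<Rightarrow> 'a list set \<Rightarrow> 'q set" where
  "steps_lang A X S = (\<Union>s\<in>S. steps A X s)"

definition generated_language :: "('q, 'a) automaton \<Rightarrow> 'a list set" where
  "generated_language G = {w \<in> lists (alphabet G). steps G (init G) w \<noteq> {}}"

definition projection :: "'a set \<Rightarrow> 'a list \<Rightarrow> 'a list" where
  "projection So w = filter (\<lambda>a. a \<in> So) w"

definition inv_projection :: "'a set \<Rightarrow> 'a set \<Rightarrow> 'a list \<Rightarrow> 'a list set" where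
  "inv_projection S So u = {w \<in> lists S. projection So w = u}"

definition weakly_k_step_opaque ::
  "('q, 'a) automaton \<Rightarrow> 'q set \<Rightarrow> 'q set \<Rightarrow> ('a list \<Rightarrow> 'a list) \<Rightarrow> enat \<Rightarrow> bool" where
  "weakly_k_step_opaque G QS QNS P k \<longleftrightarrow>
     (\<forall>s t. s @ t \<in> generated_language G \<and> enat (length (P t)) \<le> k \<and>
        steps G (steps G (init G) s \<inter> QS) t \<noteq> {} \<longrightarrow>
        (\<exists>s' t'. s' @ t' \<in> generated_language G \<and> P s = P s' \<and> P t = P t' \<and>
           steps G (steps G (init G) s' \<inter> QNS) t' \<noteq> {}))"

definition projected_automaton ::
  "('q, 'a) automaton \<Rightarrow> 'a set \<Rightarrow> ('q, 'a) automaton" where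
  "projected_automaton G So =
     \<lparr>states = states G,
      alphabet = So,
      trans = (\<lambda>q a. steps_lang G {q} (inv_projection (alphabet G) So [a])),
      init = steps_lang G (init G) (inv_projection (alphabet G) So [])\<rparr>"

text \<open>A deterministic automaton is an automaton with a singleton set of initial states and with
  singleton transition sets, so that the same notions of accessible part and product apply.\<close>

definition full_observer ::
  "('q, 'a) automaton \<Rightarrow> 'a set \<Rightarrow> ('q set, 'a) automaton" where
  "full_observer G So =
     \<lparr>states = Pow (states G),
      alphabet = So,
      trans = (\<lambda>X a. {step (projected_automaton G So) X a}),
      init = {init (projected_automaton G So)}\<rparr>"

definition accessible_part ::
  "('q, 'a) automaton \<Rightarrow> 'q set \<Rightarrow> ('q, 'a) automaton" where
  "accessible_part A B =
     A\<lparr>states := steps_lang A B (lists (alphabet A)), init := B\<rparr>"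

definition observer ::
  "('q, 'a) automaton \<Rightarrow> 'a set \<Rightarrow> ('q set, 'a) automaton" where
  "observer G So = accessible_part (full_observer G So) (init (full_observer G So))"

text \<open>The product is only formed for automata over the same alphabet.\<close>

definition product ::
  "('p, 'a) automaton \<Rightarrow> ('q, 'a) automaton \<Rightarrow> ('p \<times> 'q, 'a) automaton" where
  "product A B =
     \<lparr>states = states A \<times> states B,
      alphabet = alphabet A,
      trans = (\<lambda>(p, q) a. trans A p a \<times> trans B q a),
      init = init A \<times> init B\<rparr>"

text \<open>The loop state is \<open>(n, M, F)\<close>: the number \<open>n\<close> of completed rounds, the set \<open>M\<close> of marked
  states, and the frontier \<open>F\<close> of states marked in the last round. For finite automata the loop
  terminates even if \<open>k = \<infinity>\<close>.\<close>

definition bfs :: "('q, 'a) automaton \<Rightarrow> 'q set \<Rightarrow> enat \<Rightarrow> 'q set" where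
  "bfs A Y k =
     (case while (\<lambda>(n, M, F). F \<noteq> {} \<and> enat n < k)
        (\<lambda>(n, M, F). let N = (\<Union>a\<in>alphabet A. step A F a) - M in (Suc n, M \<union> N, N))
        (0, Y, Y)
      of (n, M, F) \<Rightarrow> M)"

definition weak_opacity ::
  "('q, 'a) automaton \<Rightarrow> 'q set \<Rightarrow> 'q set \<Rightarrow> 'a set \<Rightarrow> enat \<Rightarrow> bool" where
  "weak_opacity G QS QNS So k =
     (let Gobs = observer G So;
          PG = projected_automaton G So;
          Y = {(x, X \<inter> QNS) | x X. X \<in> states Gobs \<and> x \<in> X \<inter> QS};
          H = accessible_part (full_observer G So) (snd ` Y);
          C = product PG H;
          M = bfs C Y k
      in if \<exists>q. (q, {}) \<in> states C \<inter> M then False else True)"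

end

theory Submission imports Defs begin

text \<open>Write \<open>E X v\<close> for the set of states reachable from \<open>X\<close> by strings with projection \<open>v\<close>.
  The observer states are the sets \<open>E I u\<close>, and reading \<open>v\<close> in the product from a pair
  \<open>(x, E I u \<inter> Q\<^sub>N\<^sub>S)\<close> leads to \<open>(q, {})\<close> for some \<open>q\<close> iff \<open>E {x} v \<noteq> {}\<close> and
  \<open>E (E I u \<inter> Q\<^sub>N\<^sub>S) v = {}\<close>. Hence both sides of the equivalence say that
  \<open>E {x} v \<noteq> {}\<close> implies \<open>E (E I u \<inter> Q\<^sub>N\<^sub>S) v \<noteq> {}\<close> whenever \<open>x \<in> E I u \<inter> Q\<^sub>S\<close> and \<open>v\<close> has
  length at most \<open>k\<close>.\<close>

section \<open>Runs of automata, of products and of observers\<close>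

lemma steps_append: "steps A X (u @ v) = steps A (steps A X u) v"
  by (induction u arbitrary: X) auto

lemma steps_UN: "steps A (\<Union>i\<in>I. X i) w = (\<Union>i\<in>I. steps A (X i) w)"
proof (induction w arbitrary: X)
  case (Cons a w)
  have "step A (\<Union>i\<in>I. X i) a = (\<Union>i\<in>I. step A (X i) a)"
    by (auto simp: step_def)
  then show ?case using Cons by simp
qed simp

text \<open>Used to trace a reached state back to a single start state: a secret or nonsecret state
  of the system, or one pair in \<open>Y\<close>.\<close>

lemma steps_eq_UN_singleton: "steps A X w = (\<Union>q\<in>X. steps A {q} w)"
  using steps_UN[of A "\<lambda>q. {q}" X w] by simp

lemma steps_empty [simp]: "steps A {} w = {}"
  by (induction w) (auto simp: step_def)

lemma steps_cong_trans: "trans A = trans B \<Longrightarrow> steps A X w = steps B X w"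
  by (induction w arbitrary: X) (auto simp: step_def)

lemma steps_closed:
  assumes "\<And>q a. q \<in> S \<Longrightarrow> a \<in> alphabet A \<Longrightarrow> trans A q a \<subseteq> S"
    and "X \<subseteq> S" and "w \<in> lists (alphabet A)"
  shows "steps A X w \<subseteq> S"
  using assms(2,3)
proof (induction w arbitrary: X)
  case (Cons a w)
  then have "step A X a \<subseteq> S"
    unfolding step_def by (intro UN_least assms(1)) auto
  then show ?case using Cons by auto
qed simp

lemma steps_product:
  "steps (product A B) (X \<times> Z) w = steps A X w \<times> steps B Z w"
proof (induction w arbitrary: X Z)
  case (Cons a w)
  have "step (product A B) (X \<times> Z) a = step A X a \<times> step B Z a"
    by (auto simp: step_def product_def)
  then show ?case using Cons by simp
qed simp

lemma steps_full_observer: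
  "steps (full_observer G So) {X} w = {steps (projected_automaton G So) X w}"
  by (induction w arbitrary: X) (auto simp: step_def full_observer_def)

lemma steps_accessible_part: "steps (accessible_part A B) X w = steps A X w"
  by (rule steps_cong_trans) (simp add: accessible_part_def)

subsection \<open>Breadth-first search\<close>

text \<open>Closed form of the set marked after \<open>n\<close> rounds of the search, against which
  the loop invariant is stated. Bounding the length instead of fixing it makes the sets grow with
  \<open>n\<close>, as the marks do.\<close>

definition reach_within :: "('q, 'a) automaton \<Rightarrow> 'q set \<Rightarrow> nat \<Rightarrow> 'q set" where
  "reach_within A Y n = (\<Union>w\<in>{w \<in> lists (alphabet A). length w \<le> n}. steps A Y w)"

lemma reach_within_0: "reach_within A Y 0 = Y"
proof -
  have "{w \<in> lists (alphabet A). length w \<le> 0} = {[]}" by auto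
  then show ?thesis by (simp add: reach_within_def)
qed

lemma reach_within_mono: "m \<le> n \<Longrightarrow> reach_within A Y m \<subseteq> reach_within A Y n"
  unfolding reach_within_def by (intro UN_mono) auto

lemma reach_within_Suc:
  "reach_within A Y (Suc n) =
     reach_within A Y n \<union> (\<Union>a\<in>alphabet A. step A (reach_within A Y n) a)"
    (is "?L = ?R")
proof
  show "?L \<subseteq> ?R"
  proof
    fix q assume "q \<in> ?L"
    then obtain w where w: "w \<in> lists (alphabet A)" "length w \<le> Suc n" "q \<in> steps A Y w"
      by (auto simp: reach_within_def)
    show "q \<in> ?R"
    \<comment> \<open>The last letter is split off, since the search adds its extra step at the end
      of a word.\<close>
    proof (cases w rule: rev_cases)
      case Nil
      then show ?thesis using w reach_within_mono[of 0 n A Y] by (auto simp: reach_within_0)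
    next
      case (snoc u a)
      then obtain p where "p \<in> steps A Y u" "q \<in> trans A p a" "a \<in> alphabet A"
        "u \<in> lists (alphabet A)" "length u \<le> n"
        using w by (auto simp: steps_append step_def)
      moreover from this have "p \<in> reach_within A Y n"
        unfolding reach_within_def by blast
      ultimately show ?thesis by (auto simp: step_def)
    qed
  qed
  show "?R \<subseteq> ?L"
  proof
    fix q assume "q \<in> ?R"
    then consider "q \<in> reach_within A Y n"
      | a p where "a \<in> alphabet A" "p \<in> reach_within A Y n" "q \<in> trans A p a"
      by (auto simp: step_def)
    then show "q \<in> ?L"
    proof cases
      case 1
      then show ?thesis using reach_within_mono[of n "Suc n" A Y] by auto
    next
      case 2
      then obtain w where "w \<in> lists (alphabet A)" "length w \<le> n" "p \<in> steps A Y w"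
        by (auto simp: reach_within_def)
      then have "w @ [a] \<in> lists (alphabet A)" "length (w @ [a]) \<le> Suc n"
        "q \<in> steps A Y (w @ [a])"
        using 2 by (auto simp: steps_append step_def)
      then show ?thesis unfolding reach_within_def by blast
    qed
  qed
qed

text \<open>Once a round yields no new state, no later round can. This justifies stopping on an
  empty frontier before \<open>k\<close> rounds, in particular when \<open>k\<close> is
  infinite.\<close>

lemma reach_within_saturated:
  assumes "(\<Union>a\<in>alphabet A. step A (reach_within A Y n) a) \<subseteq> reach_within A Y n"
  shows "reach_within A Y m \<subseteq> reach_within A Y n"
proof (induction m)
  case 0
  show ?case by (rule reach_within_mono) simp
next
  case (Suc m)
  have "(\<Union>a\<in>alphabet A. step A (reach_within A Y m) a) \<subseteq>
      (\<Union>a\<in>alphabet A. step A (reach_within A Y n) a)"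
    unfolding step_def by (intro UN_mono order_refl Suc)
  then show ?case using assms Suc unfolding reach_within_Suc by blast
qed

text \<open>The set \<open>S\<close> makes the loop terminate even for infinite \<open>k\<close>,
  because its unmarked elements run out. Any finite set around \<open>Y\<close> that is closed under
  transitions can take this role.\<close>

lemma bfs_eq:
  assumes fin: "finite S" and "Y \<subseteq> S"
    and closed: "\<And>q a. q \<in> S \<Longrightarrow> a \<in> alphabet A \<Longrightarrow> trans A q a \<subseteq> S"
  shows "bfs A Y k = {q. \<exists>w\<in>lists (alphabet A). enat (length w) \<le> k \<and> q \<in> steps A Y w}"
proof -
  define succs where "succs F = (\<Union>a\<in>alphabet A. step A F a)" for F
  define R where "R = reach_within A Y"
  have R0: "R 0 = Y" and RSuc: "\<And>n. R (Suc n) = R n \<union> succs (R n)"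
    by (simp_all add: R_def succs_def reach_within_0 reach_within_Suc)
  have RS: "R n \<subseteq> S" for n
    unfolding R_def reach_within_def using steps_closed[OF closed \<open>Y \<subseteq> S\<close>] by blast
  have succs_mono: "X \<subseteq> Z \<union> W \<Longrightarrow> succs X \<subseteq> succs Z \<union> succs W" for X Z W
    unfolding succs_def step_def by blast
  \<comment> \<open>The last conjunct says that every marked state outside the frontier has already
    been expanded, so only successors of \<open>F\<close> can be new.\<close>
  define I where "I = (\<lambda>(n, M, F). enat n \<le> k \<and> M = R n \<and> F \<subseteq> M \<and> succs (M - F) \<subseteq> M)"
  define c where "c = (\<lambda>(n, M :: 'a set, F :: 'a set). F \<noteq> {} \<and> enat n < k)"
  define f where "f = (\<lambda>(n, M, F). (Suc n, M \<union> (succs F - M), succs F - M))"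
  have step_I: "I (f s)" if "I s" "c s" for s
  proof -
    obtain n M F where s: "s = (n, M, F)" by (cases s)
    from that s have i: "enat n < k" "M = R n" "F \<subseteq> M" "succs (M - F) \<subseteq> M"
      by (auto simp: I_def c_def)
    have "succs M \<subseteq> succs (M - F) \<union> succs F" "succs F \<subseteq> succs M \<union> succs M"
      using succs_mono[of M "M - F" F] succs_mono[of F M M] i(3) by auto
    then have M': "M \<union> (succs F - M) = R (Suc n)"
      using i RSuc[of n] by auto
    \<comment> \<open>Removing the new frontier leaves the old marked set, whose successors are all
      marked by now.\<close>
    moreover have "succs (M \<union> (succs F - M) - (succs F - M)) \<subseteq> M \<union> (succs F - M)"
    proof -
      have "M \<union> (succs F - M) - (succs F - M) = M" by auto
      moreover have "succs M \<subseteq> R (Suc n)" using RSuc i by auto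
      ultimately show ?thesis using M' by simp
    qed
    moreover have "succs F - M \<subseteq> R (Suc n)" using M' by blast
    moreover have "enat (Suc n) \<le> k"
      using i(1) by (simp add: Suc_ile_eq)
    ultimately show ?thesis by (simp add: I_def f_def s)
  qed
  \<comment> \<open>A round that marks nothing new leaves \<open>S - M\<close> unchanged, but empties the frontier.\<close>
  define r where "r = measure (\<lambda>(n :: nat, M, F :: 'a set). card (S - M) + of_bool (F \<noteq> {}))"
  have "case while c f (0, Y, Y) of (n, M, F) \<Rightarrow>
      M = {q. \<exists>w\<in>lists (alphabet A). enat (length w) \<le> k \<and> q \<in> steps A Y w}"
  proof (rule while_rule[where P = I and r = r])
    have "succs {} = {}" by (simp add: succs_def step_def)
    then show "I (0, Y, Y)" by (simp add: I_def R0 flip: zero_enat_def)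
  next
    show "I (f s)" if "I s" "c s" for s using step_I that .
  next
    fix s assume "I s" and nc: "\<not> c s"
    obtain n M F where s: "s = (n, M, F)" by (cases s)
    have i: "enat n \<le> k" "M = R n" "succs (M - F) \<subseteq> M" "F = {} \<or> enat n = k"
      using \<open>I s\<close> nc s by (auto simp: I_def c_def)
    \<comment> \<open>The loop ends for one of two reasons. With an empty frontier \<open>M\<close>
      is saturated and absorbs every \<open>R m\<close>; otherwise \<open>n\<close> equals
      \<open>k\<close> and monotonicity suffices.\<close>
    have "R m \<subseteq> M" if "enat m \<le> k" for m
    proof (cases "F = {}")
      case True
      then show ?thesis
        using i reach_within_saturated[of A Y n m] by (simp add: R_def succs_def)
    next
      case False
      then show ?thesis using i that reach_within_mono[of m n A Y] by (auto simp: R_def)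
    qed
    then have "M = (\<Union>m\<in>{m. enat m \<le> k}. R m)" using i by blast
    also have "\<dots> = {q. \<exists>w\<in>lists (alphabet A). enat (length w) \<le> k \<and> q \<in> steps A Y w}"
    proof -
      \<comment> \<open>Bounds up to \<open>k\<close> are closed downwards, so the bound
        \<open>m\<close> can be replaced by the exact length of the word.\<close>
      have "enat j \<le> k" if "enat m \<le> k" "j \<le> m" for j m
        using that by (meson enat_ord_simps(1) order_trans)
      then show ?thesis unfolding R_def reach_within_def by blast
    qed
    finally show "case s of (n, M, F) \<Rightarrow>
      M = {q. \<exists>w\<in>lists (alphabet A). enat (length w) \<le> k \<and> q \<in> steps A Y w}"
      by (simp add: s)
  next
    show "wf r" by (simp add: r_def)
  next
    fix s assume "I s" "c s"
    obtain n M F where s: "s = (n, M, F)" by (cases s)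
    have "M \<union> (succs F - M) \<subseteq> S" "F \<noteq> {}"
      using step_I[OF \<open>I s\<close> \<open>c s\<close>] RS \<open>c s\<close> by (auto simp: I_def f_def s c_def)
    moreover have "card (S - (M \<union> (succs F - M))) < card (S - M)" if "succs F - M \<noteq> {}"
      using fin calculation that by (intro psubset_card_mono) auto
    moreover have "M \<union> succs F = M" if "succs F - M = {}" using that by auto
    ultimately show "(f s, s) \<in> r"
      by (cases "succs F - M = {}") (auto simp: r_def f_def s)
  qed
  moreover have "bfs A Y k = (case while c f (0, Y, Y) of (n, M, F) \<Rightarrow> M)"
    by (simp only: bfs_def c_def f_def succs_def Let_def)
  ultimately show ?thesis by (cases "while c f (0, Y, Y)") simp
qed

subsection \<open>Reachability modulo projection\<close>

text \<open>This is the \<open>E\<close> of the overview. On the empty word it takes the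
  unobservable reach of \<open>X\<close>, whereas \<open>steps\<close> of the projected automaton
  leaves \<open>X\<close> unchanged.\<close>

definition obs_steps :: "('q, 'a) automaton \<Rightarrow> 'a set \<Rightarrow> 'q set \<Rightarrow> 'a list \<Rightarrow> 'q set" where
  "obs_steps G So X v = steps_lang G X (inv_projection (alphabet G) So v)"

text \<open>A word projecting to \<open>u @ v\<close> is cut right after the event that yields the
  last letter of \<open>u\<close>, or at its start if \<open>u\<close> is empty.\<close>

lemma inv_projection_append:
  "inv_projection S So (u @ v) =
     {s @ t | s t. s \<in> inv_projection S So u \<and> t \<in> inv_projection S So v}"
proof -
  have split: "\<exists>s t. w = s @ t \<and> filter (\<lambda>a. a \<in> So) s = u \<and> filter (\<lambda>a. a \<in> So) t = v"
    if "filter (\<lambda>a. a \<in> So) w = u @ v" for w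
    using that
  proof (induction u arbitrary: w)
    case Nil
    then show ?case by (metis append_Nil filter.simps(1))
  next
    case (Cons a u)
    then obtain w1 w2 where w: "w = w1 @ a # w2" "\<forall>x\<in>set w1. x \<notin> So" "a \<in> So"
      "u @ v = filter (\<lambda>a. a \<in> So) w2"
      by (auto simp: filter_eq_Cons_iff)
    obtain s t where "w2 = s @ t" "filter (\<lambda>a. a \<in> So) s = u" "filter (\<lambda>a. a \<in> So) t = v"
      using Cons.IH[of w2] w(4) by metis
    then have "w = (w1 @ a # s) @ t" "filter (\<lambda>a. a \<in> So) (w1 @ a # s) = a # u"
      using w by auto
    then show ?case using \<open>filter (\<lambda>a. a \<in> So) t = v\<close> by blast
  qed
  show ?thesis
  proof
    show "inv_projection S So (u @ v) \<subseteq>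
        {s @ t | s t. s \<in> inv_projection S So u \<and> t \<in> inv_projection S So v}"
    proof
      fix w assume "w \<in> inv_projection S So (u @ v)"
      then have w: "w \<in> lists S" "filter (\<lambda>a. a \<in> So) w = u @ v"
        by (simp_all add: inv_projection_def projection_def)
      obtain s t where "w = s @ t" "filter (\<lambda>a. a \<in> So) s = u" "filter (\<lambda>a. a \<in> So) t = v"
        using split[OF w(2)] by blast
      then show "w \<in> {s @ t | s t. s \<in> inv_projection S So u \<and> t \<in> inv_projection S So v}"
        using w(1) by (auto simp: inv_projection_def projection_def)
    qed
  qed (auto simp: inv_projection_def projection_def)
qed

lemma obs_steps_append: "obs_steps G So X (u @ v) = obs_steps G So (obs_steps G So X u) v"
  unfolding obs_steps_def steps_lang_def inv_projection_append
  by (intro set_eqI; simp add: steps_UN; metis steps_append)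

lemma subset_obs_steps_Nil: "X \<subseteq> obs_steps G So X []"
proof -
  have "[] \<in> inv_projection (alphabet G) So []"
    by (simp add: inv_projection_def projection_def)
  then show ?thesis unfolding obs_steps_def steps_lang_def by force
qed

lemma obs_steps_empty [simp]: "obs_steps G So {} v = {}"
  by (simp add: obs_steps_def steps_lang_def)

lemma step_projected_automaton:
  "step (projected_automaton G So) X a = obs_steps G So X [a]"
  by (simp add: step_def projected_automaton_def obs_steps_def steps_lang_def
      steps_eq_UN_singleton[of G X]) blast

text \<open>A transition of the projected automaton already allows unobservable events before and
  after its letter, so composing letters loses nothing. The empty word has no letter to absorb
  them.\<close>

lemma steps_projected_automaton:
  "v \<noteq> [] \<Longrightarrow> steps (projected_automaton G So) X v = obs_steps G So X v"
proof (induction v arbitrary: X)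
  case (Cons a v)
  have "obs_steps G So X (a # v) = obs_steps G So (obs_steps G So X [a]) v"
    using obs_steps_append[of G So X "[a]" v] by simp
  then show ?case using Cons
    by (cases "v = []") (simp_all add: step_projected_automaton)
qed simp

text \<open>Starting from the unobservable reach repairs the empty word. This is the initial state
  of the observer when \<open>X\<close> is \<open>init G\<close>.\<close>

lemma steps_projected_automaton_obs_steps_Nil:
  "steps (projected_automaton G So) (obs_steps G So X []) v = obs_steps G So X v"
  using obs_steps_append[of G So X "[]" v]
  by (cases "v = []") (simp_all add: steps_projected_automaton)

text \<open>The two sides can differ only on the empty word, where both are empty exactly when
  \<open>X\<close> is. Hence the algorithm may start from sets such as \<open>X \<inter> QNS\<close>
  that are not closed under unobservable events.\<close>

lemma steps_projected_automaton_empty_iff: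
  "steps (projected_automaton G So) X v = {} \<longleftrightarrow> obs_steps G So X v = {}"
  using subset_obs_steps_Nil[of X G So]
  by (cases "v = []") (auto simp: steps_projected_automaton)

lemma obs_steps_closed:
  assumes "des G" "X \<subseteq> states G"
  shows "obs_steps G So X v \<subseteq> states G"
proof -
  have "steps G X w \<subseteq> states G" if "w \<in> lists (alphabet G)" for w
    by (rule steps_closed) (use assms that in \<open>auto simp: des_def\<close>)
  then show ?thesis
    unfolding obs_steps_def steps_lang_def inv_projection_def by (intro UN_least) blast
qed

lemma mem_obs_steps_iff:
  "q \<in> obs_steps G So X v \<longleftrightarrow>
     (\<exists>w\<in>lists (alphabet G). projection So w = v \<and> q \<in> steps G X w)"
  by (auto simp: obs_steps_def steps_lang_def inv_projection_def)

lemma projection_in_lists: "projection So w \<in> lists So"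
  by (auto simp: projection_def)

lemma states_observer:
  "states (observer G So) = {obs_steps G So (init G) u | u. u \<in> lists So}"
proof -
  have "alphabet (full_observer G So) = So"
    "init (full_observer G So) = {obs_steps G So (init G) []}"
    by (simp_all add: full_observer_def projected_automaton_def obs_steps_def)
  then show ?thesis
    by (auto simp: observer_def accessible_part_def steps_lang_def steps_full_observer
        steps_projected_automaton_obs_steps_Nil)
qed

subsection \<open>Correctness of the algorithm\<close>

text \<open>The secret is a single state \<open>x\<close> to match the first components of the pairs
  in \<open>Y\<close>.\<close>

definition obs_opaque ::
  "('q, 'a) automaton \<Rightarrow> 'q set \<Rightarrow> 'q set \<Rightarrow> 'a set \<Rightarrow> enat \<Rightarrow> bool" where
  "obs_opaque G QS QNS So k \<longleftrightarrow>
     (\<forall>u\<in>lists So. \<forall>v\<in>lists So. \<forall>x\<in>obs_steps G So (init G) u \<inter> QS.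
        enat (length v) \<le> k \<longrightarrow> obs_steps G So {x} v \<noteq> {} \<longrightarrow>
        obs_steps G So (obs_steps G So (init G) u \<inter> QNS) v \<noteq> {})"

lemma append_in_generated_language:
  assumes "s \<in> lists (alphabet G)" "t \<in> lists (alphabet G)"
    and "q \<in> steps G {x} t" "x \<in> steps G (init G) s"
  shows "s @ t \<in> generated_language G"
proof -
  have "q \<in> steps G (steps G (init G) s) t"
    using assms(3,4) by (subst steps_eq_UN_singleton) auto
  then show ?thesis
    using assms(1,2) by (auto simp: generated_language_def steps_append)
qed

text \<open>The words \<open>s'\<close> and \<open>t'\<close> are constrained only through their
  projections, so the nonsecret states reached by all candidates \<open>s'\<close> can be pooled
  into one set and later separated again.\<close>

lemma weakly_k_step_opaque_iff:
  "weakly_k_step_opaque G QS QNS (projection So) k \<longleftrightarrow> obs_opaque G QS QNS So k"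
proof
  assume op: "weakly_k_step_opaque G QS QNS (projection So) k"
  show "obs_opaque G QS QNS So k"
    unfolding obs_opaque_def
  proof (intro ballI impI)
    fix u v x
    assume x: "x \<in> obs_steps G So (init G) u \<inter> QS" and k: "enat (length v) \<le> k"
      and ne: "obs_steps G So {x} v \<noteq> {}"
    obtain s where s: "s \<in> lists (alphabet G)" "projection So s = u" "x \<in> steps G (init G) s"
      using x by (auto simp: mem_obs_steps_iff)
    obtain q t where t: "t \<in> lists (alphabet G)" "projection So t = v" "q \<in> steps G {x} t"
      using ne by (metis ex_in_conv mem_obs_steps_iff)
    have "s @ t \<in> generated_language G"
      using append_in_generated_language s t by metis
    moreover have "q \<in> steps G (steps G (init G) s \<inter> QS) t"
      using x s t by (subst steps_eq_UN_singleton) auto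
    ultimately obtain s' t' where st': "s' @ t' \<in> generated_language G"
      "u = projection So s'" "v = projection So t'"
      "steps G (steps G (init G) s' \<inter> QNS) t' \<noteq> {}"
      using op k s(2) t(2) unfolding weakly_k_step_opaque_def by blast
    then obtain p y where y: "y \<in> steps G (init G) s'" "y \<in> QNS" "p \<in> steps G {y} t'"
      by (subst (asm) steps_eq_UN_singleton) auto
    have l: "s' \<in> lists (alphabet G)" "t' \<in> lists (alphabet G)"
      using st'(1) by (auto simp: generated_language_def)
    have "y \<in> obs_steps G So (init G) u \<inter> QNS"
      using y l st' by (auto simp: mem_obs_steps_iff)
    then have "p \<in> steps G (obs_steps G So (init G) u \<inter> QNS) t'"
      using y(3) by (subst steps_eq_UN_singleton) auto
    then have "p \<in> obs_steps G So (obs_steps G So (init G) u \<inter> QNS) v"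
      unfolding mem_obs_steps_iff[where v = v] using l st' by blast
    then show "obs_steps G So (obs_steps G So (init G) u \<inter> QNS) v \<noteq> {}" by blast
  qed
next
  assume op: "obs_opaque G QS QNS So k"
  show "weakly_k_step_opaque G QS QNS (projection So) k"
    unfolding weakly_k_step_opaque_def
  proof (intro allI impI, elim conjE)
    fix s t
    let ?u = "projection So s" and ?v = "projection So t"
    assume L: "s @ t \<in> generated_language G" and k: "enat (length ?v) \<le> k"
      and ne: "steps G (steps G (init G) s \<inter> QS) t \<noteq> {}"
    have l: "s \<in> lists (alphabet G)" "t \<in> lists (alphabet G)"
      using L by (auto simp: generated_language_def)
    obtain q x where x: "x \<in> steps G (init G) s" "x \<in> QS" "q \<in> steps G {x} t"
      using ne by (subst (asm) steps_eq_UN_singleton) auto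
    have "x \<in> obs_steps G So (init G) ?u \<inter> QS" "q \<in> obs_steps G So {x} ?v"
      using x l by (auto simp: mem_obs_steps_iff)
    then have "obs_steps G So (obs_steps G So (init G) ?u \<inter> QNS) ?v \<noteq> {}"
      using op[unfolded obs_opaque_def, rule_format,
          OF projection_in_lists projection_in_lists _ k] by blast
    then obtain p where "p \<in> obs_steps G So (obs_steps G So (init G) ?u \<inter> QNS) ?v"
      by blast
    then obtain t' where t': "t' \<in> lists (alphabet G)" "projection So t' = ?v"
      "p \<in> steps G (obs_steps G So (init G) ?u \<inter> QNS) t'"
      unfolding mem_obs_steps_iff[where v = ?v] by blast
    then obtain y where y: "y \<in> obs_steps G So (init G) ?u" "y \<in> QNS" "p \<in> steps G {y} t'"
      by (subst (asm) steps_eq_UN_singleton) auto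
    \<comment> \<open>The word \<open>s'\<close> is chosen after \<open>t'\<close>, to lead to the
      nonsecret state \<open>y\<close> from which \<open>t'\<close> can be read.\<close>
    then obtain s' where s': "s' \<in> lists (alphabet G)" "projection So s' = ?u"
      "y \<in> steps G (init G) s'"
      by (auto simp: mem_obs_steps_iff)
    have "s' @ t' \<in> generated_language G"
      using append_in_generated_language s' t' y by metis
    moreover have "p \<in> steps G (steps G (init G) s' \<inter> QNS) t'"
      using y s' by (subst steps_eq_UN_singleton) auto
    ultimately show "\<exists>s' t'. s' @ t' \<in> generated_language G \<and> ?u = projection So s' \<and>
        ?v = projection So t' \<and> steps G (steps G (init G) s' \<inter> QNS) t' \<noteq> {}"
      using s' t' by (metis empty_iff)
  qed
qed

text \<open>The second component of the product is deterministic, so a word leads from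
  \<open>(x, Z)\<close> to some \<open>(q, {})\<close> iff it can be read from \<open>x\<close> but
  not from \<open>Z\<close> in the projected automaton.\<close>

lemma weak_opacity_iff:
  assumes G: "des G" and QS: "QS \<subseteq> states G" and QNS: "QNS \<subseteq> states G"
  shows "weak_opacity G QS QNS So k \<longleftrightarrow> obs_opaque G QS QNS So k"
proof -
  let ?PG = "projected_automaton G So"
  let ?E = "obs_steps G So"
  define Y where "Y = {(x, X \<inter> QNS) | x X. X \<in> states (observer G So) \<and> x \<in> X \<inter> QS}"
  define H where "H = accessible_part (full_observer G So) (snd ` Y)"
  define C where "C = product ?PG H"
  have Y: "Y = {(x, ?E (init G) u \<inter> QNS) | x u. u \<in> lists So \<and> x \<in> ?E (init G) u \<inter> QS}"
    by (auto simp: Y_def states_observer)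
  have alph: "alphabet C = So" and alphH: "alphabet (full_observer G So) = So"
    by (simp_all add: C_def product_def projected_automaton_def full_observer_def)
  have steps_C: "steps C {(x, Z)} w = steps ?PG {x} w \<times> {steps ?PG Z w}" for x Z w
    using steps_product[of ?PG H "{x}" "{Z}" w]
    by (simp add: C_def H_def steps_accessible_part steps_full_observer)
  have PG_closed: "steps ?PG X w \<subseteq> states G" if "X \<subseteq> states G" for X w
    using that obs_steps_closed[OF G that]
    by (cases "w = []") (simp_all add: steps_projected_automaton)
  \<comment> \<open>All pairs are taken here, so closure under transitions needs no reasoning about
    the accessible part \<open>H\<close>.\<close>
  let ?S = "states G \<times> Pow (states G)"
  have bfs: "bfs C Y k = {p. \<exists>w\<in>lists So. enat (length w) \<le> k \<and> p \<in> steps C Y w}"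
    unfolding alph[symmetric]
  proof (rule bfs_eq[where S = ?S])
    show "finite ?S" using G by (simp add: des_def)
    show "Y \<subseteq> ?S" using QS QNS by (auto simp: Y)
    show "trans C p a \<subseteq> ?S" if "p \<in> ?S" for p a
    proof -
      obtain x Z where p: "p = (x, Z)" by (cases p)
      have "trans C p a = steps C {(x, Z)} [a]" by (simp add: p step_def)
      then show ?thesis
        using that PG_closed[of "{x}" "[a]"] PG_closed[of Z "[a]"] unfolding steps_C p
        by (auto simp del: steps.simps)
    qed
  qed
  have "(\<exists>q. (q, {}) \<in> states C \<inter> bfs C Y k) \<longleftrightarrow>
      (\<exists>w\<in>lists So. enat (length w) \<le> k \<and>
        (\<exists>(x, Z)\<in>Y. steps ?PG {x} w \<noteq> {} \<and> steps ?PG Z w = {}))" (is "?L \<longleftrightarrow> ?R")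
  proof
    assume ?L
    then obtain q w where "w \<in> lists So" "enat (length w) \<le> k" "(q, {}) \<in> steps C Y w"
      by (auto simp: bfs)
    moreover from this obtain x Z where "(x, Z) \<in> Y" "(q, {}) \<in> steps C {(x, Z)} w"
      by (subst (asm) steps_eq_UN_singleton) auto
    ultimately show ?R unfolding steps_C by fastforce
  next
    assume ?R
    then obtain w x Z q where w: "w \<in> lists So" "enat (length w) \<le> k" "(x, Z) \<in> Y"
      "q \<in> steps ?PG {x} w" "steps ?PG Z w = {}"
      by auto
    then have "(q, {}) \<in> steps C {(x, Z)} w" by (simp add: steps_C)
    then have "(q, {}) \<in> steps C Y w"
      using w(3) by (subst steps_eq_UN_singleton) auto
    then have "(q, {}) \<in> bfs C Y k" using w by (auto simp: bfs)
    moreover have "q \<in> states G"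
      using PG_closed[of "{x}" w] w QS by (auto simp: Y)
    \<comment> \<open>The marked pair must also be a state of \<open>C\<close>; the word
      \<open>w\<close> itself shows that the empty set is accessible from \<open>Z\<close>.\<close>
    moreover have "{} \<in> states H"
    proof -
      have "{} \<in> steps (full_observer G So) {Z} w" using w by (simp add: steps_full_observer)
      then have "{} \<in> steps (full_observer G So) (snd ` Y) w"
        using w(3) by (subst steps_eq_UN_singleton) force
      then show ?thesis
        using w(1) by (auto simp: H_def accessible_part_def steps_lang_def alphH)
    qed
    ultimately show ?L by (auto simp: C_def product_def projected_automaton_def)
  qed
  \<comment> \<open>Only emptiness of runs matters here, so the projected automaton can be traded
    for \<open>obs_steps\<close> on every word, the empty one included.\<close>
  also have "\<dots> \<longleftrightarrow> \<not> obs_opaque G QS QNS So k"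
    unfolding obs_opaque_def steps_projected_automaton_empty_iff Y by auto blast+
  finally have "(if \<exists>q. (q, {}) \<in> states C \<inter> bfs C Y k then False else True) \<longleftrightarrow>
      obs_opaque G QS QNS So k"
    by argo
  then show ?thesis by (simp only: weak_opacity_def Let_def C_def H_def Y_def)
qed

theorem theorem2:
  fixes G :: "('q, 'a) automaton"
    and \<Sigma>\<^sub>o \<Sigma>\<^sub>u\<^sub>o :: "'a set"
    and Q\<^sub>S Q\<^sub>N\<^sub>S :: "'q set"
    and k :: enat
  assumes "des G"
    and "alphabet G = \<Sigma>\<^sub>o \<union> \<Sigma>\<^sub>u\<^sub>o"
    and "\<Sigma>\<^sub>o \<inter> \<Sigma>\<^sub>u\<^sub>o = {}"
    and "Q\<^sub>S \<subseteq> states G"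
    and "Q\<^sub>N\<^sub>S \<subseteq> states G"
  shows "weakly_k_step_opaque G Q\<^sub>S Q\<^sub>N\<^sub>S (projection \<Sigma>\<^sub>o) k \<longleftrightarrow>
         weak_opacity G Q\<^sub>S Q\<^sub>N\<^sub>S \<Sigma>\<^sub>o k"
  using weakly_k_step_opaque_iff weak_opacity_iff[OF assms(1,4,5)] by blast

end
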